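(* Let $n\ge 2$, $r_1,\ldots,r_n>0$, $\theta>0$, and $R=\sum_{i=1}^n r_i$. Let $\lambda_1,\ldots,\lambda_n$ be independent random variables with $\lambda_i\sim\mathrm{Gamma}(r_i,\theta)$, and suppose that, conditionally on $\lambda=(\lambda_1,\ldots,\lambda_n)$, the counts $X_1,\ldots,X_n$ are mutually independent with $X_i\mid\lambda_i\sim\mathrm{Poisson}(\lambda_i)$. Let $X=(X_1,\ldots,X_n)$ and $S=\sum_{i=1}^nX_i$. Then for every integer $m\ge 0$, the conditional distribution of $X$ given $S=m$ is Dirichlet-Multinomial: for all nonnegative integers $x_1,\ldots,x_n$ with $\sum_{i=1}^n x_i=m$, $$\mathrm{Pr}(X=(x_1,\ldots,x_n)\mid S=m)=\frac{m!}{\prod_{i=1}^n x_i!}\cdot\frac{\Gamma(R)}{\Gamma(m+R)}\prod_{i=1}^n\frac{\Gamma(x_i+r_i)}{\Gamma(r_i)}.$$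
   Context: $\mathrm{Gamma}(r,\theta)$ denotes the gamma distribution with shape $r>0$ and scale $\theta>0$, i.e. with density $\frac{1}{\Gamma(r)\theta^{r}}t^{r-1}e^{-t/\theta}$ on $(0,\infty)$. $\mathrm{Poisson}(\mu)$ denotes the Poisson distribution with mean $\mu$. *)

theory Defs
  imports "HOL-Probability.Probability"
begin

text \<open>
  Shape-scale parametrisation. The library's \<open>erlang_density\<close> covers integer shapes only
  and is parametrised by the rate.
\<close>

definition gamma_density :: "real \<Rightarrow> real \<Rightarrow> real \<Rightarrow> real" where
  "gamma_density r \<theta> t =
     (if t > 0 then 1 / (Gamma r * \<theta> powr r) * t powr (r - 1) * exp (- t / \<theta>) else 0)"

definition generated_algebra ::
    "'a measure \<Rightarrow> ('i \<Rightarrow> 'b measure) \<Rightarrow> ('i \<Rightarrow> 'a \<Rightarrow> 'b) \<Rightarrow> 'i set \<Rightarrow> 'a measure" where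
  "generated_algebra M N Y I =
     vimage_algebra (space M) (\<lambda>\<omega>. \<lambda>i\<in>I. Y i \<omega>) (\<Pi>\<^sub>M i\<in>I. N i)"

definition sigma_cond_prob :: "'a measure \<Rightarrow> 'a measure \<Rightarrow> 'a set \<Rightarrow> 'a \<Rightarrow> real" where
  "sigma_cond_prob M F A = real_cond_exp M F (indicator A)"

definition cond_indep_vars ::
    "'a measure \<Rightarrow> 'a measure \<Rightarrow> ('i \<Rightarrow> 'b measure) \<Rightarrow> ('i \<Rightarrow> 'a \<Rightarrow> 'b) \<Rightarrow> 'i set \<Rightarrow> bool" where
  "cond_indep_vars M F N X I \<longleftrightarrow>
     (\<forall>i\<in>I. X i \<in> measurable M (N i)) \<and>
     (\<forall>J\<subseteq>I. J \<noteq> {} \<longrightarrow> finite J \<longrightarrow> (\<forall>A\<in>(\<Pi> j\<in>J. sets (N j)).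
        AE \<omega> in M. sigma_cond_prob M F (\<Inter>j\<in>J. X j -` A j \<inter> space M) \<omega> =
                    (\<Prod>j\<in>J. sigma_cond_prob M F (X j -` A j \<inter> space M) \<omega>)))"

text \<open>
  The family \<open>K\<close> of candidate conditional laws only matters almost everywhere; it is not
  required to be a measurable kernel, since \<open>poisson_pmf\<close> is unspecified at
  nonpositive rates.
\<close>

definition has_cond_distr ::
    "'a measure \<Rightarrow> 'a measure \<Rightarrow> 'b measure \<Rightarrow> ('a \<Rightarrow> 'b) \<Rightarrow> ('a \<Rightarrow> 'b measure) \<Rightarrow> bool" where
  "has_cond_distr M F N Y K \<longleftrightarrow>
     Y \<in> measurable M N \<and>
     (\<forall>A\<in>sets N. AE \<omega> in M. sigma_cond_prob M F (Y -` A \<inter> space M) \<omega> = measure (K \<omega>) A)"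

end

theory Submission
  imports Defs
begin

text \<open>
  Integrating out \<open>\<lambda>\<close>, the counts become independent negative binomials, so
  \<open>Pr(X = x) = C\<^sub>m \<Prod>\<^sub>i (r\<^sub>i)\<^sub>x\<^sub>i / x\<^sub>i!\<close> with rising factorials, where the
  constant \<open>C\<^sub>m\<close> depends on \<open>x\<close> only through \<open>m = \<Sum>\<^sub>i x\<^sub>i\<close>. Summing over all such \<open>x\<close>,
  the Vandermonde identity for rising factorials gives \<open>Pr(S = m) = C\<^sub>m (R)\<^sub>m / m!\<close>, and
  \<open>C\<^sub>m\<close> cancels in the quotient.
\<close>

section \<open>Weak compositions and the Vandermonde identity for rising factorials\<close>

text \<open>Membership in \<open>extensional J\<close> leaves one representative for each choice of
  values on \<open>J\<close>; this makes the set finite for finite \<open>J\<close> and lets it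
  index disjoint events.\<close>

definition compositions :: "'i set \<Rightarrow> nat \<Rightarrow> ('i \<Rightarrow> nat) set" where
  "compositions J m = {x \<in> extensional J. sum x J = m}"

lemma finite_compositions:
  assumes "finite J"
  shows "finite (compositions J m)"
proof (rule finite_subset)
  show "compositions J m \<subseteq> PiE J (\<lambda>_. {..m})"
    using assms by (auto simp: compositions_def PiE_def intro: member_le_sum)
  show "finite (PiE J (\<lambda>_. {..m}))"
    using assms by (intro finite_PiE) auto
qed

text \<open>Splitting off the value \<open>k\<close> at \<open>j\<close> leaves a composition of
  \<open>m - k\<close>; this is the induction step for sums over compositions. The inverse resets
  \<open>j\<close> to \<open>undefined\<close> so that the remainder is extensional on
  \<open>J\<close>.\<close>

lemma bij_betw_compositions_insert:
  assumes "finite J" "j \<notin> J"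
  shows "bij_betw (\<lambda>(k, x). x(j := k)) (SIGMA k:{..m}. compositions J (m - k))
           (compositions (insert j J) m)"
proof (rule bij_betw_byWitness[where f' = "\<lambda>y. (y j, y(j := undefined))"])
  have sum_upd: "(\<Sum>i\<in>J. if i = j then k else x i) = sum x J" for x :: "'a \<Rightarrow> nat" and k
    using assms by (intro sum.cong) auto
  show "\<forall>p\<in>SIGMA k:{..m}. compositions J (m - k).
      (\<lambda>y. (y j, y(j := undefined))) (case p of (k, x) \<Rightarrow> x(j := k)) = p"
    using assms by (auto simp: compositions_def extensional_def fun_eq_iff)
  show "\<forall>y\<in>compositions (insert j J) m. (case (y j, y(j := undefined)) of (k, x) \<Rightarrow> x(j := k)) = y"
    by auto
  show "(\<lambda>(k, x). x(j := k)) ` (SIGMA k:{..m}. compositions J (m - k))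
      \<subseteq> compositions (insert j J) m"
    using assms by (auto simp: compositions_def extensional_def sum_upd)
  show "(\<lambda>y. (y j, y(j := undefined))) ` compositions (insert j J) m
      \<subseteq> (SIGMA k:{..m}. compositions J (m - k))"
    using assms by (auto simp: compositions_def extensional_def sum_upd)
qed

text \<open>The multivariate Vandermonde identity. Peeling off one index and pulling out
  \<open>fact m\<close> turns the two factorials into a binomial coefficient, which leaves the
  two-variable identity \<open>pochhammer_binomial_sum\<close>.\<close>

lemma sum_prod_pochhammer_compositions:
  fixes a :: "'i \<Rightarrow> 'b :: field_char_0"
  assumes "finite J"
  shows "(\<Sum>x\<in>compositions J m. \<Prod>i\<in>J. pochhammer (a i) (x i) / fact (x i))
           = pochhammer (sum a J) m / fact m"
  using assms
proof (induction J arbitrary: m)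
  case empty
  \<comment> \<open>Only \<open>m = 0\<close> has a composition over the empty set; for positive
    \<open>m\<close> the right side vanishes too, since \<open>pochhammer 0 m = 0\<close>.\<close>
  then show ?case by (cases "m = 0") (auto simp: compositions_def pochhammer_0_left)
next
  case (insert j J)
  let ?w = "\<lambda>K x. \<Prod>i\<in>K. pochhammer (a i) (x i) / fact (x i)"
  have w: "?w (insert j J) (x(j := k)) = pochhammer (a j) k / fact k * ?w J x" for x k
  proof -
    have "?w J (x(j := k)) = ?w J x"
      using insert.hyps by (intro prod.cong) auto
    then show ?thesis using insert.hyps by simp
  qed
  have "sum (?w (insert j J)) (compositions (insert j J) m)
      = (\<Sum>(k, x)\<in>(SIGMA k:{..m}. compositions J (m - k)). ?w (insert j J) (x(j := k)))"
    by (subst sum.reindex_bij_betw[OF bij_betw_compositions_insert[OF insert.hyps], symmetric])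
       (simp add: case_prod_unfold)
  also have "\<dots> = (\<Sum>k\<le>m. \<Sum>x\<in>compositions J (m - k). pochhammer (a j) k / fact k * ?w J x)"
    unfolding w using insert.hyps finite_compositions by (subst sum.Sigma) auto
  also have "\<dots> = (\<Sum>k\<le>m. pochhammer (a j) k / fact k * (pochhammer (sum a J) (m - k) / fact (m - k)))"
    by (simp only: sum_distrib_left[symmetric] insert.IH)
  also have "\<dots> = (\<Sum>k\<le>m. of_nat (m choose k) * pochhammer (a j) k * pochhammer (sum a J) (m - k)) / fact m"
    unfolding sum_divide_distrib
    by (intro sum.cong refl) (simp add: binomial_fact field_simps)
  also have "\<dots> = pochhammer (sum a (insert j J)) m / fact m"
    using insert.hyps by (simp add: pochhammer_binomial_sum)
  finally show ?case .
qed

section \<open>Gamma integrals and the gamma-Poisson mixture\<close>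

lemma pochhammer_eq_Gamma_ratio:
  fixes a :: real
  assumes "a > 0"
  shows "pochhammer a k = Gamma (real k + a) / Gamma a"
proof -
  have "a \<notin> \<int>\<^sub>\<le>\<^sub>0" using assms by (auto elim!: nonpos_Ints_cases)
  then show ?thesis by (simp add: pochhammer_Gamma add.commute)
qed

text \<open>Euler's integral, rescaled by the substitution of \<open>c * t\<close> for
  \<open>t\<close>.\<close>

lemma has_bochner_integral_Gamma:
  assumes "(a::real) > 0" "c > 0"
  shows "has_bochner_integral lborel
           (\<lambda>t. if t > 0 then t powr (a - 1) * exp (- (c * t)) else 0) (Gamma a / c powr a)"
proof -
  let ?f = "\<lambda>t::real. indicator {0..} t * t powr (a - 1) / exp t"
  have "has_bochner_integral lborel ?f (Gamma a)"
    using assms Gamma_conv_nn_integral_real[of a] Gamma_real_pos[of a]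
    by (intro has_bochner_integral_nn_integral) auto
  then have "has_bochner_integral lborel (\<lambda>t. ?f (0 + c * t)) (Gamma a /\<^sub>R \<bar>c\<bar>)"
    using assms by (subst (asm) lborel_has_bochner_integral_real_affine_iff[where c = c and t = 0]) auto
  \<comment> \<open>The factor \<open>c powr (1 - a)\<close> cancels the power of \<open>c\<close>
    that the substitution releases from the integrand.\<close>
  then have "has_bochner_integral lborel (\<lambda>t. c powr (1 - a) * ?f (0 + c * t))
      (c powr (1 - a) * (Gamma a /\<^sub>R \<bar>c\<bar>))"
    by (rule has_bochner_integral_mult_right)
  moreover have "c powr (1 - a) * (Gamma a /\<^sub>R \<bar>c\<bar>) = Gamma a / c powr a"
    using assms by (simp add: powr_diff field_simps)
  moreover have "c powr (1 - a) * ?f (0 + c * t)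
      = (if t > 0 then t powr (a - 1) * exp (- (c * t)) else 0)" for t
  proof (cases "t > 0")
    case True
    have "c powr (1 - a) * c powr (a - 1) = 1"
      using assms by (simp add: powr_add[symmetric])
    then show ?thesis
      using True assms by (simp add: powr_mult exp_minus field_simps)
  next
    \<comment> \<open>At \<open>t = 0\<close> the indicator is 1, but
      \<open>0 powr (a - 1) = 0\<close> for every \<open>a\<close>, so both sides still
      agree.\<close>
    case False
    then show ?thesis using assms
      by (cases "t = 0") (auto simp: indicator_def zero_le_mult_iff)
  qed
  ultimately show ?thesis by simp
qed

lemma gamma_density_nonneg: "r > 0 \<Longrightarrow> 0 \<le> gamma_density r \<theta> t"
  using Gamma_real_pos[of r] by (auto simp: gamma_density_def)

text \<open>
  The \<open>if\<close> replaces \<open>poisson_pmf\<close>, whose value at nonpositive rates is unknown, by a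
  function that is measurable in the rate.
\<close>

definition poisson_weight :: "nat \<Rightarrow> real \<Rightarrow> real" where
  "poisson_weight k t = (if t > 0 then t ^ k / fact k * exp (- t) else 0)"

lemma poisson_weight_measurable [measurable]: "poisson_weight k \<in> borel_measurable borel"
  unfolding poisson_weight_def by measurable

text \<open>The value is a negative binomial mass. Multiplying by the Poisson weight gives an
  unnormalised gamma density of shape \<open>r + k\<close> and rate \<open>1 + 1 / \<theta>\<close>,
  so the integral is Euler's.\<close>

lemma has_bochner_integral_gamma_poisson:
  assumes "r > 0" "\<theta> > 0"
  shows "has_bochner_integral lborel (\<lambda>t. gamma_density r \<theta> t * poisson_weight k t)
           (pochhammer r k / fact k / (\<theta> powr r * (1 + 1 / \<theta>) powr (r + real k)))"
proof -
  define c where "c = 1 + 1 / \<theta>"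
  have c: "c > 0" using assms by (simp add: c_def add_pos_pos)
  let ?K = "1 / (Gamma r * \<theta> powr r * fact k)"
  have "has_bochner_integral lborel
      (\<lambda>t. ?K * (if t > 0 then t powr (r + real k - 1) * exp (- (c * t)) else 0))
      (?K * (Gamma (r + real k) / c powr (r + real k)))"
    using assms c by (intro has_bochner_integral_mult_right has_bochner_integral_Gamma) auto
  moreover have "?K * (if t > 0 then t powr (r + real k - 1) * exp (- (c * t)) else 0)
      = gamma_density r \<theta> t * poisson_weight k t" for t
  proof (cases "t > 0")
    case True
    have "t powr (r + real k - 1) = t powr (r - 1) * t ^ k"
      using True by (simp add: powr_realpow[symmetric] powr_add[symmetric] algebra_simps)
    moreover have "exp (- (c * t)) = exp (- t / \<theta>) * exp (- t)"
      by (simp add: exp_add[symmetric] c_def algebra_simps)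
    ultimately show ?thesis
      using True by (simp add: gamma_density_def poisson_weight_def)
  qed (simp add: gamma_density_def)
  ultimately show ?thesis
    using assms by (simp add: pochhammer_eq_Gamma_ratio c_def field_simps)
qed

section \<open>Conditional probabilities and the joint law of the counts\<close>

lemma subalgebra_generated_algebra:
  assumes "\<And>i. i \<in> I \<Longrightarrow> Y i \<in> measurable M (N i)"
  shows "subalgebra M (generated_algebra M N Y I)"
proof -
  have "(\<lambda>\<omega>. \<lambda>i\<in>I. Y i \<omega>) \<in> measurable M (\<Pi>\<^sub>M i\<in>I. N i)"
    using assms by (intro measurable_restrict)
  moreover from this have "(\<lambda>\<omega>. \<lambda>i\<in>I. Y i \<omega>) \<in> space M \<rightarrow> space (\<Pi>\<^sub>M i\<in>I. N i)"
    by (auto dest: measurable_space)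
  ultimately show ?thesis
    unfolding subalgebra_def generated_algebra_def
    by (auto simp: sets_vimage_algebra2 intro: measurable_sets)
qed

text \<open>The tower property; it turns almost-everywhere conditional statements into unconditional
  probabilities.\<close>

lemma (in prob_space) integral_sigma_cond_prob:
  assumes "subalgebra M F" "A \<in> events"
  shows "(\<integral>\<omega>. sigma_cond_prob M F A \<omega> \<partial>M) = prob A"
proof -
  interpret finite_measure_subalgebra M F
    using assms by unfold_locales
  show ?thesis
    unfolding sigma_cond_prob_def
    using assms by (subst real_cond_exp_int(2)) (auto simp: integrable_indicator_iff less_top[symmetric])
qed

text \<open>Independence enters twice: conditional independence of the counts factors the
  conditional probability, and independence of the rates factors its expectation. The exponents then
  add up, so the denominator depends on \<open>x\<close> only through
  \<open>sum x I\<close>.\<close>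

lemma (in prob_space) prob_mixed_poisson:
  fixes X :: "'i \<Rightarrow> 'a \<Rightarrow> nat" and lam :: "'i \<Rightarrow> 'a \<Rightarrow> real"
  assumes I: "finite I" "I \<noteq> {}"
    and r: "\<And>i. i \<in> I \<Longrightarrow> r i > 0" and \<theta>: "\<theta> > 0"
    and indep: "indep_vars (\<lambda>_. borel) lam I"
    and distr: "\<And>i. i \<in> I \<Longrightarrow>
      distributed M lborel (lam i) (\<lambda>t. ennreal (gamma_density (r i) \<theta> t))"
    and F: "subalgebra M F"
    and cond_indep: "cond_indep_vars M F (\<lambda>_. count_space UNIV) X I"
    and cond_distr: "\<And>i. i \<in> I \<Longrightarrow>
      has_cond_distr M F (count_space UNIV) (X i) (\<lambda>\<omega>. measure_pmf (poisson_pmf (lam i \<omega>)))"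
  shows "\<P>(\<omega> in M. \<forall>i\<in>I. X i \<omega> = x i) =
    (\<Prod>i\<in>I. pochhammer (r i) (x i) / fact (x i)) /
      (\<theta> powr sum r I * (1 + 1 / \<theta>) powr (sum r I + real (sum x I)))"
proof -
  define E where "E i = X i -` {x i} \<inter> space M" for i
  have E_sets: "E i \<in> events" if "i \<in> I" for i
    unfolding E_def using that cond_indep
    by (intro measurable_sets) (auto simp: cond_indep_vars_def)
  have event_eq: "{\<omega> \<in> space M. \<forall>i\<in>I. X i \<omega> = x i} = (\<Inter>i\<in>I. E i)"
    using I by (auto simp: E_def)
  have lam_meas: "lam i \<in> borel_measurable M" if "i \<in> I" for i
    using indep that by (auto simp: indep_vars_def)
  \<comment> \<open>The gamma law charges only positive rates, so off a null set
    \<open>poisson_pmf\<close> has its usual mass function.\<close>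
  have lam_pos: "AE \<omega> in M. lam i \<omega> > 0" if "i \<in> I" for i
    using distributed_AE2[OF distr[OF that], of "\<lambda>t. t > 0"]
    by (auto simp: gamma_density_def)
  have marginal: "AE \<omega> in M. sigma_cond_prob M F (E i) \<omega> = poisson_weight (x i) (lam i \<omega>)"
    if "i \<in> I" for i
  proof -
    have "AE \<omega> in M. sigma_cond_prob M F (E i) \<omega> = measure (poisson_pmf (lam i \<omega>)) {x i}"
      using cond_distr[OF that] by (auto simp: has_cond_distr_def E_def)
    with lam_pos[OF that] show ?thesis
      by eventually_elim (simp add: measure_pmf_single poisson_weight_def)
  qed
  \<comment> \<open>Conditional independence is applied with \<open>J = I\<close>, which has to be
    nonempty, and the singletons \<open>{x i}\<close>.\<close>
  have "AE \<omega> in M. sigma_cond_prob M F (\<Inter>i\<in>I. E i) \<omega> = (\<Prod>i\<in>I. sigma_cond_prob M F (E i) \<omega>)"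
    using cond_indep I unfolding cond_indep_vars_def E_def
    by (elim conjE allE[of _ I]) (auto dest!: bspec[where x = "\<lambda>i. {x i}"])
  moreover have "AE \<omega> in M. \<forall>i\<in>I. sigma_cond_prob M F (E i) \<omega> = poisson_weight (x i) (lam i \<omega>)"
    using I marginal by (intro AE_finite_allI)
  ultimately have ae: "AE \<omega> in M. sigma_cond_prob M F (\<Inter>i\<in>I. E i) \<omega>
      = (\<Prod>i\<in>I. poisson_weight (x i) (lam i \<omega>))"
    by eventually_elim simp
  note gp = has_bochner_integral_gamma_poisson[OF r \<theta>, unfolded has_bochner_integral_iff]
  have marginal_integrable: "integrable M (\<lambda>\<omega>. poisson_weight (x i) (lam i \<omega>))" if "i \<in> I" for i
    using gp[OF that] r[OF that]
    by (subst distributed_integrable[OF distr[OF that], symmetric]) (auto simp: gamma_density_nonneg)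
  have marginal_integral: "(\<integral>\<omega>. poisson_weight (x i) (lam i \<omega>) \<partial>M)
      = pochhammer (r i) (x i) / fact (x i) / (\<theta> powr r i * (1 + 1 / \<theta>) powr (r i + real (x i)))"
    if "i \<in> I" for i
    using gp[OF that] r[OF that]
    by (subst distributed_integral[OF distr[OF that], symmetric]) (auto simp: gamma_density_nonneg)
  have indep': "indep_vars (\<lambda>_. borel) (\<lambda>i \<omega>. poisson_weight (x i) (lam i \<omega>)) I"
    using indep by (rule indep_vars_compose2) simp
  have "prob (\<Inter>i\<in>I. E i) = (\<integral>\<omega>. sigma_cond_prob M F (\<Inter>i\<in>I. E i) \<omega> \<partial>M)"
    using I E_sets by (intro integral_sigma_cond_prob[OF F, symmetric] sets.finite_INT) auto
  also have "\<dots> = (\<integral>\<omega>. (\<Prod>i\<in>I. poisson_weight (x i) (lam i \<omega>)) \<partial>M)"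
    using ae lam_meas
    by (intro integral_cong_AE) (auto simp: sigma_cond_prob_def
        intro!: borel_measurable_prod measurable_compose[OF lam_meas poisson_weight_measurable])
  also have "\<dots> = (\<Prod>i\<in>I. pochhammer (r i) (x i) / fact (x i) /
      (\<theta> powr r i * (1 + 1 / \<theta>) powr (r i + real (x i))))"
    using indep_vars_lebesgue_integral[OF I(1) indep' marginal_integrable] marginal_integral
    by simp
  also have "\<dots> = (\<Prod>i\<in>I. pochhammer (r i) (x i) / fact (x i)) /
      (\<theta> powr sum r I * (1 + 1 / \<theta>) powr (sum r I + real (sum x I)))"
  proof -
    have "1 + 1 / \<theta> > 0" using \<theta> by (simp add: add_pos_pos)
    then show ?thesis
      using \<theta> I by (simp add: prod_dividef prod.distrib powr_sum[symmetric] sum.distrib)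
  qed
  finally show ?thesis unfolding event_eq .
qed

section \<open>The law of the total and conditioning on it\<close>

text \<open>The event is partitioned by the count vector restricted to \<open>I\<close>; distinct
  extensional functions differ somewhere on \<open>I\<close>, which gives disjointness.\<close>

lemma (in prob_space) prob_sum_eq:
  fixes X :: "'i \<Rightarrow> 'a \<Rightarrow> nat"
  assumes I: "finite I" and X: "\<And>i. i \<in> I \<Longrightarrow> X i \<in> measurable M (count_space UNIV)"
  shows "\<P>(\<omega> in M. (\<Sum>i\<in>I. X i \<omega>) = m)
           = (\<Sum>x\<in>compositions I m. \<P>(\<omega> in M. \<forall>i\<in>I. X i \<omega> = x i))"
proof -
  let ?E = "\<lambda>x. {\<omega> \<in> space M. \<forall>i\<in>I. X i \<omega> = x i}"
  have "?E x \<in> events" for x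
    using I X by measurable
  moreover have "disjoint_family_on ?E (compositions I m)"
    by (fastforce simp: disjoint_family_on_def compositions_def intro: extensionalityI)
  moreover have "{\<omega> \<in> space M. (\<Sum>i\<in>I. X i \<omega>) = m} = (\<Union>x\<in>compositions I m. ?E x)"
  proof (intro equalityI subsetI)
    fix \<omega> assume "\<omega> \<in> {\<omega> \<in> space M. (\<Sum>i\<in>I. X i \<omega>) = m}"
    then show "\<omega> \<in> (\<Union>x\<in>compositions I m. ?E x)"
      by (intro UN_I[of "\<lambda>i\<in>I. X i \<omega>"]) (auto simp: compositions_def)
  qed (auto simp: compositions_def)
  ultimately show ?thesis
    using I finite_compositions by (subst finite_measure_finite_Union[symmetric]) auto
qed

theorem mainTheorem3:
  fixes M :: "'a measure" and n :: nat and r :: "nat \<Rightarrow> real" and \<theta> R :: real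
    and lam :: "nat \<Rightarrow> 'a \<Rightarrow> real" and X :: "nat \<Rightarrow> 'a \<Rightarrow> nat" and \<Lambda> :: "'a measure"
    and S :: "'a \<Rightarrow> nat"
  assumes "prob_space M"
    and "n \<ge> 2"
    and "\<And>i. i \<in> {1..n} \<Longrightarrow> r i > 0"
    and "\<theta> > 0"
    and "R = (\<Sum>i\<in>{1..n}. r i)"
    and "prob_space.indep_vars M (\<lambda>_. borel) lam {1..n}"
    and "\<And>i. i \<in> {1..n} \<Longrightarrow> distributed M lborel (lam i) (\<lambda>t. ennreal (gamma_density (r i) \<theta> t))"
    and "\<Lambda> = generated_algebra M (\<lambda>_. borel) lam {1..n}"
    and "cond_indep_vars M \<Lambda> (\<lambda>_. count_space UNIV) X {1..n}"
    and "\<And>i. i \<in> {1..n} \<Longrightarrow>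
           has_cond_distr M \<Lambda> (count_space UNIV) (X i) (\<lambda>\<omega>. measure_pmf (poisson_pmf (lam i \<omega>)))"
    and "S = (\<lambda>\<omega>. \<Sum>i\<in>{1..n}. X i \<omega>)"
  shows "\<forall>m::nat. \<forall>x::nat \<Rightarrow> nat. (\<Sum>i\<in>{1..n}. x i) = m \<longrightarrow>
           \<P>(\<omega> in M. (\<forall>i\<in>{1..n}. X i \<omega> = x i) \<bar> S \<omega> = m) =
             fact m / (\<Prod>i\<in>{1..n}. fact (x i)) * (Gamma R / Gamma (real m + R)) *
             (\<Prod>i\<in>{1..n}. Gamma (real (x i) + r i) / Gamma (r i))"
proof (intro allI impI)
  fix m :: nat and x :: "nat \<Rightarrow> nat"
  assume x: "(\<Sum>i\<in>{1..n}. x i) = m"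
  interpret prob_space M by fact
  let ?I = "{1..n}"
  \<comment> \<open>The factor from \<open>prob_mixed_poisson\<close> shared by all vectors of total
    \<open>m\<close>; being nonzero, it cancels in the quotient.\<close>
  define C where "C = 1 / (\<theta> powr R * (1 + 1 / \<theta>) powr (R + real m))"
  have C: "C \<noteq> 0"
    using assms(4) by (simp add: C_def add_pos_pos[THEN less_imp_neq, symmetric])
  have F: "subalgebra M \<Lambda>"
    unfolding assms(8) using assms(6)
    by (intro subalgebra_generated_algebra) (auto simp: indep_vars_def)
  \<comment> \<open>Stated for every \<open>y\<close> of total \<open>m\<close>: the numerator uses
    it at \<open>x\<close>, the denominator sums it over all compositions.\<close>
  have joint: "\<P>(\<omega> in M. \<forall>i\<in>?I. X i \<omega> = y i) =
      C * (\<Prod>i\<in>?I. pochhammer (r i) (y i) / fact (y i))" if "sum y ?I = m" for y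
    using prob_mixed_poisson[OF _ _ assms(3,4,6,7) F assms(9,10), of y] assms(2) that
    by (simp add: C_def assms(5) del: of_nat_sum)
  have "\<P>(\<omega> in M. S \<omega> = m) = (\<Sum>y\<in>compositions ?I m. \<P>(\<omega> in M. \<forall>i\<in>?I. X i \<omega> = y i))"
    unfolding assms(11) using assms(9)
    by (intro prob_sum_eq) (auto simp: cond_indep_vars_def)
  also have "\<dots> = C * (\<Sum>y\<in>compositions ?I m. \<Prod>i\<in>?I. pochhammer (r i) (y i) / fact (y i))"
    unfolding sum_distrib_left by (intro sum.cong refl joint) (simp add: compositions_def)
  also have "\<dots> = C * (pochhammer R m / fact m)"
    by (simp add: sum_prod_pochhammer_compositions assms(5))
  finally have total: "\<P>(\<omega> in M. S \<omega> = m) = C * (pochhammer R m / fact m)" .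
  have "R > 0"
    unfolding assms(5) using assms(2,3) by (intro sum_pos) auto
  \<comment> \<open>Since \<open>x\<close> has total \<open>m\<close>, fixing the counts already
    forces \<open>S \<omega> = m\<close>, so the numerator is just the joint probability.\<close>
  have "(\<omega> \<in> space M \<and> (\<forall>i\<in>?I. X i \<omega> = x i) \<and> S \<omega> = m)
      \<longleftrightarrow> (\<omega> \<in> space M \<and> (\<forall>i\<in>?I. X i \<omega> = x i))" for \<omega>
    using x by (auto simp: assms(11))
  then have "\<P>(\<omega> in M. (\<forall>i\<in>?I. X i \<omega> = x i) \<bar> S \<omega> = m)
      = (\<Prod>i\<in>?I. pochhammer (r i) (x i) / fact (x i)) / (pochhammer R m / fact m)"
    unfolding cond_prob_def total using C joint[OF x] by simp
  also have "\<dots> = fact m / (\<Prod>i\<in>?I. fact (x i)) * (1 / pochhammer R m) *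
      (\<Prod>i\<in>?I. pochhammer (r i) (x i))"
    by (simp add: prod_dividef)
  also have "(\<Prod>i\<in>?I. pochhammer (r i) (x i)) = (\<Prod>i\<in>?I. Gamma (real (x i) + r i) / Gamma (r i))"
    using assms(3) by (intro prod.cong refl pochhammer_eq_Gamma_ratio) auto
  also have "1 / pochhammer R m = Gamma R / Gamma (real m + R)"
    using \<open>R > 0\<close> by (simp add: pochhammer_eq_Gamma_ratio)
  finally show "\<P>(\<omega> in M. (\<forall>i\<in>?I. X i \<omega> = x i) \<bar> S \<omega> = m) =
      fact m / (\<Prod>i\<in>?I. fact (x i)) * (Gamma R / Gamma (real m + R)) *
      (\<Prod>i\<in>?I. Gamma (real (x i) + r i) / Gamma (r i))" .
qed

end
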